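(* Let $\lambda$ be a nonzero real number. Define the degenerate Bernoulli numbers of the second kind $b_{n,\lambda}$ by $$\frac{\lambda t}{(1+t)^\lambda-1}=\sum_{n=0}^\infty b_{n,\lambda}\frac{t^n}{n!}.$$ Then for every integer $n\ge 0$, $$b_{n,\lambda}=(-1)^n\left\{\frac{(1)_{n+1,\lambda}}{n+1}+\sum_{i=0}^{n-1}\frac{(1)_{i+1,\lambda}}{(i+1)!}\big(a_{i,\lambda}(n)-n\,a_{i,\lambda}(n-1)\big)\right\}$$ $$=\frac{(-1)^n(1)_{n+1,\lambda}}{n+1}+\sum_{i=0}^{n-1}\sum_{k=i}^n\frac{(1)_{i+1,\lambda}}{(i+1)!}(-1)^k k!\binom{k}{i}\lambda^{n-i-1}\big(\lambda S_{2,\frac1\lambda}(n,k)+nS_{2,\frac1\lambda}(n-1,k)\big)$$ $$=\frac{(-1)^n(1)_{n+1,\lambda}}{n+1}+\sum_{i=0}^{n-1}\frac{(1)_{i+1,\lambda}}{(i+1)!}\lambda^{-i}\left\{\sum_{l=0}^n(-1)^l\binom{n}{i}\binom{n}{l}(\lambda l)_n+\sum_{k=i}^{n-1}\sum_{l=0}^k(-1)^l\binom{k}{i}\binom{k}{l}(\lambda l+1)_n\right\},$$ where $S_{2,\frac1\lambda}(n-1,n)=0$.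
   Context: $(x)_{n,\lambda}$ denotes the generalized falling factorial: $(x)_{0,\lambda}=1$ and $(x)_{n,\lambda}=x(x-\lambda)\cdots(x-(n-1)\lambda)$ for $n\ge1$; $(x)_n=(x)_{n,1}$ is the ordinary falling factorial. Let $F(t)=\frac{\lambda}{(1+t)^\lambda-1}$. For $N\ge1$ the numbers $a_{i,\lambda}(N)$, $0\le i\le N$, are the coefficients with $F^{(N)}(t)=\left(\frac{-1}{1+t}\right)^N\sum_{i=0}^N a_{i,\lambda}(N)F(t)^{i+1}$, and $a_{0,\lambda}(0)=1$ (consistent with $F^{(0)}=F$). For $\mu\ne0$ the degenerate Stirling numbers of the second kind are defined by $\frac{1}{k!}\big((1+\mu t)^{1/\mu}-1\big)^k=\sum_{n=k}^\infty S_{2,\mu}(n,k)\frac{t^n}{n!}$; here $\mu=1/\lambda$. *)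

theory Defs
  imports Complex_Main "HOL-Computational_Algebra.Formal_Laurent_Series"
begin

text \<open>
  All generating functions are read as formal series in the variable \<open>t\<close>, over the reals:
  \<open>(1 + t) ^ c\<close> is the binomial series \<^const>\<open>fps_binomial\<close>, and \<open>F\<close>, which has a simple pole
  at \<open>t = 0\<close>, is a formal Laurent series.
\<close>

definition gen_ffact :: "real \<Rightarrow> nat \<Rightarrow> real \<Rightarrow> real" where
  "gen_ffact x n lam = (\<Prod>j<n. x - real j * lam)"

definition deg_bernoulli2 :: "real \<Rightarrow> nat \<Rightarrow> real" where
  "deg_bernoulli2 lam n =
     fact n * fps_nth (fps_const lam * fps_X / (fps_binomial lam - 1)) n"

text \<open>The substitution \<open>t \<mapsto> \<mu> t\<close> turns the binomial series into \<open>(1 + \<mu> t) ^ (1 / \<mu>)\<close>.\<close>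

definition deg_stirling2 :: "real \<Rightarrow> nat \<Rightarrow> nat \<Rightarrow> real" where
  "deg_stirling2 \<mu> n k =
     fact n * fps_nth (fps_const (1 / fact k) *
       (fps_compose (fps_binomial (1 / \<mu>)) (fps_const \<mu> * fps_X) - 1) ^ k) n"

definition F_ser :: "real \<Rightarrow> real fls" where
  "F_ser lam = fls_const lam / (fps_to_fls (fps_binomial lam) - 1)"

definition is_deriv_coeffs :: "real \<Rightarrow> nat \<Rightarrow> (nat \<Rightarrow> real) \<Rightarrow> bool" where
  "is_deriv_coeffs lam N c \<longleftrightarrow>
     (fls_deriv ^^ N) (F_ser lam) =
       (- 1 / (1 + fls_X)) ^ N * (\<Sum>i\<le>N. fls_const (c i) * F_ser lam ^ (i + 1))"

text \<open>
  The coefficients exist and are unique for \<open>lam \<noteq> 0\<close>, see \<open>deriv_coeffs_ex1\<close> below. Beyond \<open>i = N\<close>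
  they are set to zero, to make the sequence unique.
\<close>

definition deriv_coeff :: "real \<Rightarrow> nat \<Rightarrow> nat \<Rightarrow> real" where
  "deriv_coeff lam i N = (THE c. is_deriv_coeffs lam N c \<and> (\<forall>j>N. c j = 0)) i"


lemma deg_bernoulli2_genfun:
  assumes "lam \<noteq> 0"
  shows "Abs_fps (\<lambda>n. deg_bernoulli2 lam n / fact n) * (fps_binomial lam - 1) = fps_const lam * fps_X"
proof -
  have n1: "fps_nth (fps_binomial lam - 1) 1 = lam" by simp
  have nz: "fps_binomial lam - 1 \<noteq> 0" using n1 assms by force
  have "subdegree (fps_binomial lam - 1) = 1"
    by (rule subdegreeI) (use assms in auto)
  moreover have "subdegree (fps_const lam * fps_X) = 1"
    by (rule subdegreeI) (use assms in auto)
  ultimately have "(fps_binomial lam - 1) dvd (fps_const lam * fps_X)"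
    using nz assms by (subst fps_dvd_iff) auto
  moreover have "Abs_fps (\<lambda>n. deg_bernoulli2 lam n / fact n)
      = fps_const lam * fps_X / (fps_binomial lam - 1)"
    by (simp add: fps_eq_iff deg_bernoulli2_def)
  ultimately show ?thesis by simp
qed

lemma deg_stirling2_genfun:
  "fps_const (1 / fact k) *
     (fps_compose (fps_binomial (1 / \<mu>)) (fps_const \<mu> * fps_X) - 1) ^ k =
   Abs_fps (\<lambda>n. deg_stirling2 \<mu> n k / fact n)"
  by (simp add: fps_eq_iff deg_stirling2_def)

lemma deg_stirling2_eq_0:
  assumes "n < k"
  shows "deg_stirling2 \<mu> n k = 0"
proof -
  have "fps_nth ((fps_compose (fps_binomial (1 / \<mu>)) (fps_const \<mu> * fps_X) - 1) ^ k) n = 0"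
    using assms by (intro startsby_zero_power_prefix[rule_format]) auto
  then show ?thesis by (simp add: deg_stirling2_def)
qed


lemma F_ser_denom:
  assumes "lam \<noteq> 0"
  shows "fps_to_fls (fps_binomial lam) - 1 \<noteq> (0 :: real fls)"
    and "fls_subdegree (fps_to_fls (fps_binomial lam) - 1 :: real fls) = 1"
proof -
  show 1: "fls_subdegree (fps_to_fls (fps_binomial lam) - 1 :: real fls) = 1"
    by (rule fls_subdegree_eqI) (use assms in \<open>auto simp: not_less\<close>)
  then show "fps_to_fls (fps_binomial lam) - 1 \<noteq> (0 :: real fls)" by auto
qed

lemma F_ser_nz:
  assumes "lam \<noteq> 0"
  shows "F_ser lam \<noteq> 0" "fls_subdegree (F_ser lam) = -1"
proof -
  show 1: "F_ser lam \<noteq> 0" using F_ser_denom[OF assms] assms by (simp add: F_ser_def)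
  have "F_ser lam * (fps_to_fls (fps_binomial lam) - 1) = fls_const lam"
    using F_ser_denom[OF assms] by (simp add: F_ser_def)
  then have "fls_subdegree (F_ser lam * (fps_to_fls (fps_binomial lam) - 1)) = 0"
    by simp
  then show "fls_subdegree (F_ser lam) = -1"
    using 1 F_ser_denom[OF assms] by (subst (asm) fls_subdegree_mult) auto
qed

lemma one_plus_X_nz: "1 + fls_X \<noteq> (0 :: real fls)"
proof
  assume "1 + fls_X = (0 :: real fls)"
  then have "fls_nth (1 + fls_X :: real fls) 0 = 0" by simp
  then show False by simp
qed

lemma F_ser_deriv:
  assumes "lam \<noteq> 0"
  shows "fls_deriv (F_ser lam) =
    (- 1 / (1 + fls_X)) * (fls_const lam * F_ser lam + F_ser lam ^ 2)"
proof -
  let ?B = "fps_to_fls (fps_binomial lam)"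
  let ?D = "?B - 1"
  let ?F = "F_ser lam"
  have FD: "?F * ?D = fls_const lam"
    using F_ser_denom[OF assms] by (simp add: F_ser_def)
  have "(1 + fps_X) * fps_deriv (fps_binomial lam) = fps_const lam * fps_binomial lam"
    by (simp add: fps_binomial_deriv fps_divide_unit mult_ac inverse_mult_eq_1')
  then have "fps_to_fls ((1 + fps_X) * fps_deriv (fps_binomial lam)) =
      fps_to_fls (fps_const lam * fps_binomial lam)" by simp
  then have XB: "(1 + fls_X) * fls_deriv ?B = fls_const lam * ?B"
    by (simp add: fls_times_fps_to_fls fls_deriv_fps_to_fls)
  have "fls_deriv (?F * ?D) = 0" by (simp only: FD fls_deriv_const)
  then have e: "fls_deriv ?F * ?D = - (?F * fls_deriv ?B)"
    by (simp add: eq_neg_iff_add_eq_0 add.commute)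
  have "((1 + fls_X) * fls_deriv ?F) * ?D = - (?F * ((1 + fls_X) * fls_deriv ?B))"
    using arg_cong[OF e, of "\<lambda>x. (1 + fls_X) * x"] by (simp add: mult_ac)
  also have "\<dots> = - (?F * (?F * ?D * (?D + 1)))" by (simp only: XB FD) simp
  also have "\<dots> = - (?F * (?F * ?D) + ?F * ?F) * ?D" by algebra
  finally have "(1 + fls_X) * fls_deriv ?F = - (?F * (?F * ?D) + ?F * ?F)"
    using F_ser_denom[OF assms] by simp
  then show ?thesis using one_plus_X_nz
    unfolding FD by (simp add: divide_simps power2_eq_square mult_ac)
qed

lemma deriv_coeffs_ex:
  assumes "lam \<noteq> 0"
  shows "\<exists>c. is_deriv_coeffs lam N c \<and> (\<forall>j>N. c j = 0)"
proof (induction N)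
  case 0
  show ?case
    by (rule exI[of _ "\<lambda>i. if i = 0 then 1 else 0"]) (simp add: is_deriv_coeffs_def)
next
  case (Suc N)
  then obtain c where c: "is_deriv_coeffs lam N c" "\<forall>j>N. c j = 0" by blast
  let ?F = "F_ser lam"
  define th where "th = (- 1 / (1 + fls_X) :: real fls)"
  define c' where
    "c' i = (real N + real (i + 1) * lam) * c i + (if i = 0 then 0 else real i * c (i - 1))" for i
  let ?E = "\<Sum>i\<le>N. fls_const (c i) * ?F ^ (i + 1)"
  have th1: "th * (1 + fls_X) = -1" using one_plus_X_nz by (simp add: th_def)
  have "fls_deriv (th * (1 + fls_X)) = 0" unfolding th1 by simp
  then have "fls_deriv th * (1 + fls_X) = - th"
    by (simp add: eq_neg_iff_add_eq_0 add.commute)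
  then have "fls_deriv th * (th * (1 + fls_X)) = - (th ^ 2)" by algebra
  then have th': "fls_deriv th = th ^ 2" unfolding th1 by simp
  have thN: "fls_deriv (th ^ N) = of_nat N * th ^ Suc N"
    unfolding fls_deriv_power th' by (cases N) (simp_all only: power2_eq_square mult_ac
      power_Suc diff_Suc_1 of_nat_0 mult_zero_left mult_zero_right)
  have of_nat_fls: "of_nat m = fls_const (real m)" for m
    by (simp add: fls_of_nat)
  have E1: "fls_deriv (fls_const (c i) * ?F ^ (i + 1)) =
      th * (fls_const (real (i + 1) * c i) * (fls_const lam * ?F ^ (i + 1) + ?F ^ (i + 2)))" for i
  proof -
    have "fls_deriv (fls_const (c i) * ?F ^ (i + 1)) =
        fls_const (c i) * (fls_const (real (i + 1)) * ?F ^ i * (th * (fls_const lam * ?F + ?F ^ 2)))"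
      unfolding fls_deriv_mult_const_left fls_deriv_power F_ser_deriv[OF assms] of_nat_fls th_def
      by simp
    also have "\<dots> = th * ((fls_const (real (i + 1)) * fls_const (c i)) *
        (fls_const lam * ?F ^ (i + 1) + ?F ^ (i + 2)))"
      by (simp only: power_add power_one_right) algebra
    finally show ?thesis by (simp only: fls_const_mult_const)
  qed
  have E': "fls_deriv ?E = th * (\<Sum>i\<le>N. fls_const (real (i + 1) * c i) *
      (fls_const lam * ?F ^ (i + 1) + ?F ^ (i + 2)))"
    unfolding fls_deriv_sum sum_distrib_left by (intro sum.cong refl E1)
  have "(fls_deriv ^^ Suc N) ?F = fls_deriv (th ^ N * ?E)"
    using c(1) by (simp add: is_deriv_coeffs_def th_def)
  also have "\<dots> = th ^ N * fls_deriv ?E + fls_deriv (th ^ N) * ?E" by (rule fls_deriv_mult)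
  also have "\<dots> = th ^ Suc N * ((\<Sum>i\<le>N. fls_const (real (i + 1) * c i) *
      (fls_const lam * ?F ^ (i + 1) + ?F ^ (i + 2))) + fls_const (real N) * ?E)"
    unfolding E' thN of_nat_fls by (simp only: power_Suc distrib_left mult_ac)
  also have "(\<Sum>i\<le>N. fls_const (real (i + 1) * c i) *
      (fls_const lam * ?F ^ (i + 1) + ?F ^ (i + 2))) + fls_const (real N) * ?E
    = (\<Sum>i\<le>N. fls_const ((real N + real (i + 1) * lam) * c i) * ?F ^ (i + 1))
      + (\<Sum>i\<le>N. fls_const (real (i + 1) * c i) * ?F ^ (i + 2))"
    unfolding sum_distrib_left sum.distrib[symmetric]
  proof (intro sum.cong refl)
    fix i
    have "fls_const ((real N + real (i + 1) * lam) * c i) =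
        fls_const (real N) * fls_const (c i) + fls_const (real (i + 1) * c i) * fls_const lam"
      by (simp only: fls_const_mult_const fls_plus_const) (simp add: algebra_simps)
    then show "fls_const (real (i + 1) * c i) * (fls_const lam * ?F ^ (i + 1) + ?F ^ (i + 2)) +
        fls_const (real N) * (fls_const (c i) * ?F ^ (i + 1)) =
      fls_const ((real N + real (i + 1) * lam) * c i) * ?F ^ (i + 1) +
        fls_const (real (i + 1) * c i) * ?F ^ (i + 2)"
      by (simp only: distrib_left distrib_right mult_ac add_ac)
  qed
  also have "\<dots> = (\<Sum>i\<le>Suc N. fls_const (c' i) * ?F ^ (i + 1))"
  proof -
    have "(\<Sum>i\<le>Suc N. fls_const (c' i) * ?F ^ (i + 1)) =
      (\<Sum>i\<le>Suc N. fls_const ((real N + real (i + 1) * lam) * c i) * ?F ^ (i + 1)) +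
      (\<Sum>i\<le>Suc N. fls_const (if i = 0 then 0 else real i * c (i - 1)) * ?F ^ (i + 1))"
      unfolding sum.distrib[symmetric] c'_def
      by (intro sum.cong refl) (simp only: fls_plus_const[symmetric] distrib_right)
    also have "(\<Sum>i\<le>Suc N. fls_const ((real N + real (i + 1) * lam) * c i) * ?F ^ (i + 1)) =
      (\<Sum>i\<le>N. fls_const ((real N + real (i + 1) * lam) * c i) * ?F ^ (i + 1))"
      using c(2) by simp
    also have "(\<Sum>i\<le>Suc N. fls_const (if i = 0 then 0 else real i * c (i - 1)) * ?F ^ (i + 1)) =
      (\<Sum>i\<le>N. fls_const (real (i + 1) * c i) * ?F ^ (i + 2))"
      by (subst sum.atMost_Suc_shift) simp
    finally show ?thesis by simp
  qed
  finally have "is_deriv_coeffs lam (Suc N) c'"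
    unfolding is_deriv_coeffs_def th_def .
  moreover have "\<forall>j>Suc N. c' j = 0" using c(2) by (auto simp: c'_def)
  ultimately show ?case by blast
qed

lemma F_ser_powers_indep:
  assumes "lam \<noteq> 0" and "(\<Sum>i\<le>N. fls_const (d i) * F_ser lam ^ (i + 1)) = 0" and "i \<le> N"
  shows "d i = 0"
  using assms(2,3)
proof (induction N arbitrary: i)
  have sub: "fls_subdegree (F_ser lam ^ (i + 1)) = - int (i + 1)" for i
    using F_ser_nz[OF assms(1)] by (subst fls_subdegree_pow) simp
  have nz: "fls_nth (F_ser lam ^ (i + 1)) (- int (i + 1)) \<noteq> 0" for i
    using F_ser_nz(1)[OF assms(1)] sub[of i]
    by (metis nth_fls_subdegree_zero_iff power_not_zero)
  {
    case 0
    then show ?case using F_ser_nz(1)[OF assms(1)] by simp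
  next
    case (Suc N)
    have low: "fls_nth (F_ser lam ^ (i + 1)) (- int (Suc N + 1)) = 0" if "i \<le> N" for i
      using that sub[of i] by (intro fls_eq0_below_subdegree) linarith
    have "0 = fls_nth (\<Sum>i\<le>Suc N. fls_const (d i) * F_ser lam ^ (i + 1)) (- int (Suc N + 1))"
      using Suc.prems(1) by simp
    also have "\<dots> = (\<Sum>i\<le>Suc N. d i * fls_nth (F_ser lam ^ (i + 1)) (- int (Suc N + 1)))"
      by (simp only: fls_nth_sum fls_mult_const_nth)
    also have "\<dots> = d (Suc N) * fls_nth (F_ser lam ^ (Suc N + 1)) (- int (Suc N + 1))"
      unfolding sum.atMost_Suc using low by simp
    finally have top: "d (Suc N) = 0" using nz[of "Suc N"] by simp
    show ?case
    proof (cases "i = Suc N")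
      case False
      then show ?thesis using Suc.IH[of i] Suc.prems top by simp
    qed (use top in simp)
  }
qed

lemma deriv_coeffs_ex1:
  assumes "lam \<noteq> 0"
  shows "\<exists>!c. is_deriv_coeffs lam N c \<and> (\<forall>j>N. c j = 0)"
proof (rule ex_ex1I)
  show "\<exists>c. is_deriv_coeffs lam N c \<and> (\<forall>j>N. c j = 0)" using deriv_coeffs_ex[OF assms] .
next
  fix c d
  assume c: "is_deriv_coeffs lam N c \<and> (\<forall>j>N. c j = 0)"
    and d: "is_deriv_coeffs lam N d \<and> (\<forall>j>N. d j = 0)"
  have "(- 1 / (1 + fls_X)) ^ N \<noteq> (0 :: real fls)" using one_plus_X_nz by simp
  moreover have "(- 1 / (1 + fls_X)) ^ N * (\<Sum>i\<le>N. fls_const (c i) * F_ser lam ^ (i + 1)) =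
      (- 1 / (1 + fls_X)) ^ N * (\<Sum>i\<le>N. fls_const (d i) * F_ser lam ^ (i + 1))"
    using c d unfolding is_deriv_coeffs_def by (elim conjE) (rule trans[OF sym])
  ultimately have "(\<Sum>i\<le>N. fls_const (c i) * F_ser lam ^ (i + 1)) =
      (\<Sum>i\<le>N. fls_const (d i) * F_ser lam ^ (i + 1))"
    using mult_left_cancel by fast
  then have "(\<Sum>i\<le>N. fls_const (c i - d i) * F_ser lam ^ (i + 1)) = 0"
    by (simp only: fls_minus_const[symmetric] left_diff_distrib sum_subtractf right_minus_eq)
  then have "c i = d i" if "i \<le> N" for i
    using F_ser_powers_indep[OF assms, of "\<lambda>i. c i - d i" N i] that by simp
  moreover have "c i = d i" if "\<not> i \<le> N" for i
    using c d that by simp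
  ultimately show "c = d" by blast
qed

lemma is_deriv_coeffs_deriv_coeff:
  assumes "lam \<noteq> 0"
  shows "is_deriv_coeffs lam N (\<lambda>i. deriv_coeff lam i N)"
  using theI'[OF deriv_coeffs_ex1[OF assms, of N]] by (simp add: deriv_coeff_def)

lemma deriv_coeff_0_0:
  assumes "lam \<noteq> 0"
  shows "deriv_coeff lam 0 0 = 1"
proof -
  have "fls_const (deriv_coeff lam 0 0) * F_ser lam = fls_const 1 * F_ser lam"
    using is_deriv_coeffs_deriv_coeff[OF assms, of 0] by (simp add: is_deriv_coeffs_def)
  then have "fls_const (deriv_coeff lam 0 0) = (fls_const 1 :: real fls)"
    using F_ser_nz(1)[OF assms] by (metis mult_right_cancel)
  then show ?thesis by (metis fls_const_nth)
qed

end

theory Submission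
  imports Defs
begin

text \<open>
  Put \<open>z = 1 / F = ((1 + t) ^ lam - 1) / lam\<close>, a local parameter at \<open>t = 0\<close>. Multiplying
  \<open>(t F)\<^bsup>(n)\<^esup> = t F\<^bsup>(n)\<^esup> + n F\<^bsup>(n-1)\<^esup>\<close> by \<open>(- (1 + t)) ^ n\<close> and writing \<open>t = (1 + t) - 1\<close> gives
  \<open>(- (1 + t)) ^ n (t F)\<^bsup>(n)\<^esup> = (1 + t) (\<Sum>i. (a\<^sub>i(n) - n a\<^sub>i(n-1)) F ^ (i + 1)) - (\<Sum>i. a\<^sub>i(n) F ^ (i + 1))\<close>.
  The first formula compares the constant coefficients of both sides as Laurent series in \<open>z\<close>: on
  the left it is \<open>(- 1) ^ n b\<^sub>n\<close>, the last sum contributes nothing, and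
  \<open>1 + t = (1 + lam z) ^ (1 / lam)\<close> gives the coefficients \<open>(1)\<^bsub>i+1\<^esub> / (i + 1)!\<close>. The other two formulas
  follow by solving the recurrence of \<open>a\<^sub>i(n)\<close> in terms of finite differences of falling factorials,
  which are degenerate Stirling numbers up to scaling.
\<close>

section \<open>Falling factorials and their finite differences\<close>

lemma gen_ffact_Suc: "gen_ffact x (Suc n) lam = gen_ffact x n lam * (x - real n * lam)"
  by (simp add: gen_ffact_def)

lemma fact_mult_gbinomial: "fact n * (x gchoose n) = gen_ffact x n 1"
  by (simp add: gbinomial_mult_fact gen_ffact_def atLeast0LessThan)

text \<open>The forward difference in \<open>x\<close>; it is the source of the shifted argument
  \<open>lam * real l + 1\<close> in the third formula.\<close>

lemma gen_ffact_plus_1: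
  "gen_ffact (x + 1) n 1 = gen_ffact x n 1 + real n * gen_ffact x (n - 1) 1"
proof (cases n)
  case (Suc m)
  have "gen_ffact (x + 1) (Suc m) 1 = (x + 1) * gen_ffact x m 1"
    unfolding gen_ffact_def by (subst prod.lessThan_Suc_shift) simp
  then show ?thesis
    using Suc by (simp add: gen_ffact_Suc algebra_simps)
qed (simp add: gen_ffact_def)

text \<open>Up to sign, the \<open>k\<close>-th finite difference at \<open>0\<close> of \<open>l \<mapsto> (lam l)\<^sub>n\<close>.\<close>

definition ffact_diff :: "real \<Rightarrow> nat \<Rightarrow> nat \<Rightarrow> real" where
  "ffact_diff lam n k = (\<Sum>l\<le>k. (-1) ^ l * real (k choose l) * gen_ffact (lam * real l) n 1)"

text \<open>Binomial expansion of \<open>(1 - ?E) ^ k\<close>, where \<open>?E\<close> is (1 + t /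
  lam)^lam: each \<open>?E ^ l\<close> is again a binomial series in t / lam, with exponent l lam,
  so its n-th coefficient is (lam l)_n / (n! lam^n).\<close>

lemma ffact_diff_eq_deg_stirling2:
  assumes "lam \<noteq> 0"
  shows "ffact_diff lam n k = (-1) ^ k * fact k * lam ^ n * deg_stirling2 (1 / lam) n k"
proof -
  let ?E = "fps_compose (fps_binomial lam) (fps_const (1 / lam) * fps_X)"
  have pow: "fps_nth (?E ^ l) n = (real l * lam gchoose n) / lam ^ n" for l
  proof -
    have "?E ^ l = fps_compose (fps_binomial (real l * lam)) (fps_const (1 / lam) * fps_X)"
      by (simp add: fps_compose_power fps_binomial_power)
    then show ?thesis by (simp add: power_one_over)
  qed
  have neg_power: "(- f) ^ l = fps_const ((-1) ^ l) * f ^ l" for f :: "real fps" and l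
  proof -
    have "(-1) ^ l = fps_const ((-1 :: real) ^ l)"
      by (metis fps_const_1_eq_1 fps_const_neg fps_const_power)
    then show ?thesis by (metis power_minus)
  qed
  have "fps_nth ((1 - ?E) ^ k) n =
      fps_nth (\<Sum>l\<le>k. of_nat (k choose l) * (- ?E) ^ l * 1 ^ (k - l)) n"
    by (subst binomial_ring[symmetric]) simp
  also have "\<dots> = (\<Sum>l\<le>k. fps_nth (fps_const ((-1) ^ l * real (k choose l)) * ?E ^ l) n)"
    unfolding fps_sum_nth
    by (intro sum.cong refl)
       (simp only: neg_power power_one mult_1_right fps_of_nat[symmetric]
         fps_const_mult[symmetric] mult_ac mult_1_left)
  also have "\<dots> = (\<Sum>l\<le>k. (-1) ^ l * real (k choose l) * ((real l * lam gchoose n) / lam ^ n))"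
    by (simp only: fps_mult_left_const_nth pow)
  finally have "fact n * lam ^ n * fps_nth ((1 - ?E) ^ k) n = ffact_diff lam n k"
    using assms
    by (simp add: ffact_diff_def sum_distrib_left fact_mult_gbinomial[symmetric] mult_ac)
  moreover have "(1 - ?E) ^ k = fps_const ((-1) ^ k) * (?E - 1) ^ k"
    using neg_power[of "?E - 1" k] by simp
  ultimately show ?thesis by (simp add: deg_stirling2_def mult_ac)
qed

text \<open>A k-th difference of a polynomial in l of degree n < k vanishes. This lets the sums over
  k below be extended or cut off freely.\<close>

lemma ffact_diff_eq_0:
  assumes "lam \<noteq> 0" and "n < k"
  shows "ffact_diff lam n k = 0"
  using assms by (simp add: ffact_diff_eq_deg_stirling2 deg_stirling2_eq_0)

text \<open>The new factor lam l - n of the falling factorial splits the sum; in the part with l,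
  absorption turns l binom(k,l) into k (binom(k,l) - binom(k-1,l)).\<close>

lemma ffact_diff_Suc:
  "ffact_diff lam (Suc n) k =
    (lam * real k - real n) * ffact_diff lam n k - lam * real k * ffact_diff lam n (k - 1)"
proof (cases k)
  case 0
  then show ?thesis by (simp add: ffact_diff_def gen_ffact_Suc)
next
  case (Suc m)
  let ?g = "\<lambda>l. (-1) ^ l * gen_ffact (lam * real l) n 1"
  have absorb: "real l * real (Suc m choose l) = real (Suc m) * (real (Suc m choose l) - real (m choose l))"
    if "l \<le> Suc m" for l
  proof -
    have "real (Suc m - l) * real (Suc m choose l) = real (Suc m) * real (m choose l)"
      using binomial_absorb_comp[of "Suc m" l] by (metis diff_Suc_1 of_nat_mult)
    then show ?thesis using that by (simp add: of_nat_diff algebra_simps)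
  qed
  have 1: "ffact_diff lam n m = (\<Sum>l\<le>Suc m. real (m choose l) * ?g l)"
    by (simp add: ffact_diff_def mult_ac)
  have 2: "ffact_diff lam n k = (\<Sum>l\<le>Suc m. real (Suc m choose l) * ?g l)"
    unfolding ffact_diff_def Suc by (simp only: mult_ac)
  have 3: "ffact_diff lam (Suc n) k =
    lam * (\<Sum>l\<le>Suc m. real l * real (Suc m choose l) * ?g l) -
    real n * (\<Sum>l\<le>Suc m. real (Suc m choose l) * ?g l)"
    unfolding ffact_diff_def Suc sum_distrib_left sum_subtractf[symmetric] by (intro sum.cong refl) (simp only: gen_ffact_Suc algebra_simps)
  have 4: "(\<Sum>l\<le>Suc m. real l * real (Suc m choose l) * ?g l) =
    real (Suc m) * ((\<Sum>l\<le>Suc m. real (Suc m choose l) * ?g l) - (\<Sum>l\<le>Suc m. real (m choose l) * ?g l))"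
    unfolding sum_subtractf[symmetric] sum_distrib_left
    by (intro sum.cong refl) (simp only: absorb atMost_iff left_diff_distrib right_diff_distrib mult.assoc)
  have "k - 1 = m" and "real k = real (Suc m)" using Suc by simp_all
  then show ?thesis unfolding 3 4 1[symmetric] 2[symmetric] by (simp add: algebra_simps)
qed

section \<open>Recurrence and closed form of the coefficients a_i(N)\<close>

lemma one_plus_X_times_deriv_F_ser:
  assumes "lam \<noteq> 0"
  shows "(1 + fls_X) * fls_deriv (F_ser lam) = - (fls_const lam * F_ser lam + F_ser lam ^ 2)"
proof -
  have "x * (- 1 / x * y) = - y" if "x \<noteq> 0" for x y :: "real fls"
    using that by simp
  then show ?thesis unfolding F_ser_deriv[OF assms] using one_plus_X_nz by blast
qed

text \<open>Clears the denominator, so that the polynomial in F stands alone on one side.\<close>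

lemma is_deriv_coeffs_alt:
  "is_deriv_coeffs lam N c \<longleftrightarrow>
    (- (1 + fls_X)) ^ N * (fls_deriv ^^ N) (F_ser lam) =
      (\<Sum>i\<le>N. fls_const (c i) * F_ser lam ^ (i + 1))"
proof -
  have "- x * (- 1 / x) = 1" if "x \<noteq> 0" for x :: "real fls"
    using that by simp
  then have "(- (1 + fls_X)) ^ N * (- 1 / (1 + fls_X)) ^ N = (1 :: real fls)"
    unfolding power_mult_distrib[symmetric] by (simp only: one_plus_X_nz power_one not_False_eq_True)
  moreover have "d = y * s \<longleftrightarrow> x * d = s" if "x * y = 1" for x y d s :: "real fls"
    using that by (auto simp: mult.assoc[symmetric] mult.commute[of y x])
  ultimately show ?thesis
    unfolding is_deriv_coeffs_def by blast
qed

text \<open>With \<open>?T\<close> = - (1 + t), applying \<open>?T\<close> d/dt to \<open>?P\<close>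
  = \<open>?T ^ N\<close> F^(N) gives \<open>?T ^ Suc N\<close> F^(N+1) - N \<open>?P\<close>; on
  the polynomial side \<open>?T\<close> F' = lam F + F^2.\<close>

lemma deriv_coeffs_Suc:
  fixes N :: nat
  assumes "lam \<noteq> 0" and "is_deriv_coeffs lam N c" and "c (Suc N) = 0"
  shows "is_deriv_coeffs lam (Suc N)
    (\<lambda>i. (real N + real (i + 1) * lam) * c i + real i * c (i - 1))"
proof -
  let ?F = "F_ser lam"
  let ?T = "- (1 + fls_X) :: real fls"
  let ?P = "\<Sum>i\<le>N. fls_const (c i) * ?F ^ (i + 1)"
  have P: "?P = ?T ^ N * (fls_deriv ^^ N) ?F"
    using assms(2) unfolding is_deriv_coeffs_alt by (rule sym)
  have "T * fls_deriv (T ^ N) = - (of_nat N * T ^ N)" if "fls_deriv T = - 1" for T :: "real fls"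
    unfolding fls_deriv_power that by (cases N) (simp_all add: algebra_simps)
  then have TN: "?T * fls_deriv (?T ^ N) = - (of_nat N * ?T ^ N)" by simp
  have "?T * fls_deriv ?P = ?T * fls_deriv (?T ^ N) * (fls_deriv ^^ N) ?F
      + ?T ^ Suc N * (fls_deriv ^^ Suc N) ?F"
    unfolding P fls_deriv_mult funpow.simps o_def power_Suc by (simp only: algebra_simps)
  then have rec: "?T ^ Suc N * (fls_deriv ^^ Suc N) ?F = ?T * fls_deriv ?P + of_nat N * ?P"
    unfolding TN P by (simp only: algebra_simps) simp
  have TF: "?T * fls_deriv ?F = fls_const lam * ?F + ?F ^ 2"
    using one_plus_X_times_deriv_F_ser[OF assms(1)] by (simp only: minus_mult_left[symmetric] minus_minus)
  have "?T * fls_deriv (fls_const (c i) * ?F ^ (i + 1)) + of_nat N * (fls_const (c i) * ?F ^ (i + 1)) =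
      fls_const ((real N + real (i + 1) * lam) * c i) * ?F ^ (i + 1) +
      fls_const (real (i + 1) * c i) * ?F ^ (i + 2)" for i
  proof -
    have "?T * fls_deriv (fls_const (c i) * ?F ^ (i + 1)) =
        fls_const (c i) * of_nat (i + 1) * ?F ^ i * (?T * fls_deriv ?F)"
      unfolding fls_deriv_mult_const_left fls_deriv_power by (simp add: mult_ac)
    also have "\<dots> = fls_const (c i) * of_nat (i + 1) * (fls_const lam * ?F ^ (i + 1) + ?F ^ (i + 2))"
      unfolding TF by (simp add: algebra_simps power2_eq_square)
    finally show ?thesis
      by (simp only: fls_of_nat fls_const_mult_const[symmetric] fls_plus_const[symmetric] algebra_simps)
  qed
  then have "?T * fls_deriv ?P + of_nat N * ?P =
      (\<Sum>i\<le>N. fls_const ((real N + real (i + 1) * lam) * c i) * ?F ^ (i + 1)) +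
      (\<Sum>i\<le>N. fls_const (real (i + 1) * c i) * ?F ^ (i + 2))"
    unfolding fls_deriv_sum sum_distrib_left sum.distrib[symmetric] by simp
  \<comment> \<open>Both sums get the range up to \<open>Suc N\<close>: here the new term vanishes
    by assumption, and in the shifted sum the term i = 0 has factor 0.\<close>
  also have "(\<Sum>i\<le>N. fls_const ((real N + real (i + 1) * lam) * c i) * ?F ^ (i + 1)) =
      (\<Sum>i\<le>Suc N. fls_const ((real N + real (i + 1) * lam) * c i) * ?F ^ (i + 1))"
    using assms(3) by simp
  also have "(\<Sum>i\<le>N. fls_const (real (i + 1) * c i) * ?F ^ (i + 2)) =
      (\<Sum>i\<le>Suc N. fls_const (real i * c (i - 1)) * ?F ^ (i + 1))"
    by (subst sum.atMost_Suc_shift) simp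
  finally show ?thesis
    unfolding is_deriv_coeffs_alt rec sum.distrib[symmetric]
    by (simp only: fls_plus_const[symmetric] distrib_right)
qed

lemma deriv_coeff_eqI:
  assumes "lam \<noteq> 0" and "is_deriv_coeffs lam N c" and "\<And>j. j > N \<Longrightarrow> c j = 0"
  shows "deriv_coeff lam i N = c i"
proof -
  have "(THE c. is_deriv_coeffs lam N c \<and> (\<forall>j>N. c j = 0)) = c"
    using assms by (intro the1_equality deriv_coeffs_ex1) auto
  then show ?thesis by (simp add: deriv_coeff_def)
qed

lemma deriv_coeff_eq_0:
  assumes "lam \<noteq> 0" and "N < i"
  shows "deriv_coeff lam i N = 0"
  using theI'[OF deriv_coeffs_ex1[OF assms(1), of N]] assms(2) by (simp add: deriv_coeff_def)

lemma deriv_coeff_Suc: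
  assumes "lam \<noteq> 0"
  shows "deriv_coeff lam i (Suc N) =
    (real N + real (i + 1) * lam) * deriv_coeff lam i N + real i * deriv_coeff lam (i - 1) N"
  by (rule deriv_coeff_eqI[OF assms deriv_coeffs_Suc[OF assms is_deriv_coeffs_deriv_coeff[OF assms]]])
     (simp_all add: deriv_coeff_eq_0 assms)

text \<open>On the diagonal only the second term of the recurrence survives.\<close>

lemma deriv_coeff_diag:
  assumes "lam \<noteq> 0"
  shows "deriv_coeff lam n n = fact n"
  by (induction n) (simp_all add: deriv_coeff_0_0 deriv_coeff_Suc deriv_coeff_eq_0 assms)

text \<open>By \<open>ffact_diff_Suc\<close> the right-hand side obeys the same recurrence in N as
  \<open>deriv_coeff\<close>.\<close>

lemma deriv_coeff_eq_sum:
  assumes "lam \<noteq> 0"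
  shows "deriv_coeff lam i N =
    (-1) ^ N / lam ^ i * (\<Sum>k\<le>N. real (k choose i) * ffact_diff lam N k)"
proof (induction N arbitrary: i)
  case 0
  then show ?case
    by (cases i) (simp_all add: deriv_coeff_0_0 deriv_coeff_eq_0 assms ffact_diff_def gen_ffact_def)
next
  case (Suc N)
  let ?W = "ffact_diff lam N"
  let ?S = "\<lambda>i. \<Sum>k\<le>N. real (k choose i) * ?W k"
  have "(\<Sum>k\<le>Suc N. real (k choose i) * ffact_diff lam (Suc N) k) =
      (\<Sum>k\<le>Suc N. real (k choose i) * (lam * real k - real N) * ?W k) -
      (\<Sum>k\<le>Suc N. lam * real k * real (k choose i) * ?W (k - 1))"
    unfolding sum_subtractf[symmetric] ffact_diff_Suc by (simp only: algebra_simps)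
  \<comment> \<open>The top term contains \<open>ffact_diff lam N (Suc N)\<close>, which is
    0.\<close>
  also have "(\<Sum>k\<le>Suc N. real (k choose i) * (lam * real k - real N) * ?W k) =
      (\<Sum>k\<le>N. real (k choose i) * (lam * real k - real N) * ?W k)"
    using assms by (simp add: ffact_diff_eq_0)
  also have "(\<Sum>k\<le>Suc N. lam * real k * real (k choose i) * ?W (k - 1)) =
      (\<Sum>k\<le>N. lam * real (Suc k) * real (Suc k choose i) * ?W k)"
    by (subst sum.atMost_Suc_shift) simp
  finally have S: "(\<Sum>k\<le>Suc N. real (k choose i) * ffact_diff lam (Suc N) k) =
      (\<Sum>k\<le>N. (real (k choose i) * (lam * real k - real N) -
        lam * real (Suc k) * real (Suc k choose i)) * ?W k)"
    unfolding sum_subtractf[symmetric] by (simp only: left_diff_distrib)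
  show ?case
  proof (cases i)
    case 0
    have "(\<Sum>k\<le>Suc N. real (k choose i) * ffact_diff lam (Suc N) k) = - (real N + lam) * ?S 0"
      unfolding S sum_distrib_left by (intro sum.cong refl) (simp add: 0 algebra_simps)
    then show ?thesis
      using 0 by (simp only: deriv_coeff_Suc[OF assms] Suc.IH) (simp add: algebra_simps)
  next
    case (Suc j)
    have "(\<Sum>k\<le>Suc N. real (k choose i) * ffact_diff lam (Suc N) k) =
      - (real N + real (i + 1) * lam) * ?S i - lam * real i * ?S j"
      unfolding S sum_distrib_left sum_subtractf[symmetric]
    proof (intro sum.cong refl)
      fix k
      \<comment> \<open>Absorption, together with Pascal's rule, reduces the claim to an identity
        between the coefficients of each \<open>?W k\<close>.\<close>
      have "real (Suc j) * real (Suc k choose Suc j) = real (Suc k) * real (k choose j)"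
        using Suc_times_binomial[of j k] by (metis of_nat_mult)
      then have "real (k choose i) * (lam * real k - real N) - lam * real (Suc k) * real (Suc k choose i) =
          - (real N + real (i + 1) * lam) * real (k choose i) - lam * real i * real (k choose j)"
        unfolding Suc by simp algebra
      then show "(real (k choose i) * (lam * real k - real N) - lam * real (Suc k) * real (Suc k choose i)) * ?W k =
        - (real N + real (i + 1) * lam) * (real (k choose i) * ?W k) - lam * real i * (real (k choose j) * ?W k)"
        by (simp only:) (simp only: left_diff_distrib mult.assoc)
    qed
    then show ?thesis
      using assms Suc by (simp only: deriv_coeff_Suc[OF assms] Suc.IH) (simp add: field_simps)
  qed
qed

section \<open>Constant coefficients with respect to the local parameter 1 / F\<close>

lemma fls_X_times_F_ser:
  fixes lam :: real
  assumes "lam \<noteq> 0"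
  defines "G \<equiv> Abs_fps (\<lambda>n. deg_bernoulli2 lam n / fact n)"
  shows "fls_X * F_ser lam = fps_to_fls G" and "fps_nth G 0 = 1"
proof -
  have G: "G * (fps_binomial lam - 1) = fps_const lam * fps_X"
    unfolding G_def by (rule deg_bernoulli2_genfun[OF assms(1)])
  have "fps_to_fls G * (fps_to_fls (fps_binomial lam) - 1) = fls_const lam * fls_X"
    using arg_cong[OF G, of fps_to_fls] by (simp add: fls_times_fps_to_fls)
  then show "fls_X * F_ser lam = fps_to_fls G"
    using F_ser_denom[OF assms(1)] by (simp add: F_ser_def field_simps)
  \<comment> \<open>As (1 + t)^lam - 1 starts with lam t, this coefficient is lam times the constant
    term of \<open>G\<close>.\<close>
  have "fps_nth (G * (fps_binomial lam - 1)) 1 = lam" unfolding G by simp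
  then show "fps_nth G 0 = 1" using assms(1) by (simp add: fps_mult_nth)
qed

text \<open>
  With \<open>z = 1 / F\<close>, which has a simple zero at \<open>t = 0\<close>, the constant coefficient of \<open>f\<close> as a Laurent
  series in \<open>z\<close> is the residue of \<open>f z' / z = - f F' / F\<close>.
\<close>

definition const_coeff_inv_F :: "real \<Rightarrow> real fls \<Rightarrow> real" where
  "const_coeff_inv_F lam f = fls_residue (f * (- fls_deriv (F_ser lam) / F_ser lam))"

lemma const_coeff_inv_F_const_times:
  "const_coeff_inv_F lam (fls_const c * f) = c * const_coeff_inv_F lam f"
  unfolding const_coeff_inv_F_def mult.assoc fls_residue_fls_const_times ..

lemma const_coeff_inv_F_diff:
  "const_coeff_inv_F lam (f - g) = const_coeff_inv_F lam f - const_coeff_inv_F lam g"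
  by (simp only: const_coeff_inv_F_def left_diff_distrib fls_residue_def fls_minus_nth)

lemma const_coeff_inv_F_sum:
  "const_coeff_inv_F lam (\<Sum>i\<in>A. f i) = (\<Sum>i\<in>A. const_coeff_inv_F lam (f i))"
  unfolding const_coeff_inv_F_def sum_distrib_right fls_residue_def fls_nth_sum ..

text \<open>Since t F = \<open>G\<close> is an invertible power series, - F' / F = 1 / t - G' / G,
  and only the pole 1 / t contributes to the residue.\<close>

lemma const_coeff_inv_F_fps:
  assumes "lam \<noteq> 0"
  shows "const_coeff_inv_F lam (fps_to_fls g) = fps_nth g 0"
proof -
  let ?F = "F_ser lam"
  define G where "G = Abs_fps (\<lambda>n. deg_bernoulli2 lam n / fact n)"
  have XF: "fls_X * ?F = fps_to_fls G" and G0: "fps_nth G 0 = 1"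
    using fls_X_times_F_ser[OF assms] by (simp_all add: G_def)
  have "fls_deriv (fls_X * ?F) = fps_to_fls (fps_deriv G)"
    unfolding XF fls_deriv_fps_to_fls ..
  then have dG: "?F + fls_X * fls_deriv ?F = fps_to_fls (fps_deriv G)"
    by (simp add: add.commute)
  have Gnz: "fps_to_fls G \<noteq> 0" using XF F_ser_nz(1)[OF assms] by (metis fls_X_nonzero mult_eq_0_iff)
  have "G * (fps_deriv G * inverse G) = fps_deriv G"
    using G0 by (simp add: mult.left_commute inverse_mult_eq_1')
  then have GG: "fps_to_fls G * fps_to_fls (fps_deriv G * inverse G) = fps_to_fls (fps_deriv G)"
    by (metis fls_times_fps_to_fls)
  have "fps_to_fls G * (- fls_deriv ?F / ?F) = - (fls_X * fls_deriv ?F)"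
    using F_ser_nz(1)[OF assms] by (simp add: XF[symmetric])
  also have "\<dots> = ?F - fps_to_fls (fps_deriv G)" by (simp add: dG[symmetric])
  finally have quot: "fps_to_fls G * (- fls_deriv ?F / ?F) = ?F - fps_to_fls (fps_deriv G)" .
  have FG: "?F = fps_to_fls G * fls_X_inv"
    unfolding XF[symmetric] by (simp add: mult_ac fls_X_inv_times_conv_shift fls_X_times_conv_shift)
  have "fps_to_fls G * (- fls_deriv ?F / ?F) =
      fps_to_fls G * (fls_X_inv - fps_to_fls (fps_deriv G * inverse G))"
    unfolding quot right_diff_distrib GG FG[symmetric] ..
  then have "- fls_deriv ?F / ?F = fls_X_inv - fps_to_fls (fps_deriv G * inverse G)"
    using Gnz by (metis mult_left_cancel)
  then have "fps_to_fls g * (- fls_deriv ?F / ?F) =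
      fls_X_inv * fps_to_fls g - fps_to_fls (g * (fps_deriv G * inverse G))"
    by (simp add: right_diff_distrib fls_times_fps_to_fls mult.commute)
  then show ?thesis
    by (simp add: const_coeff_inv_F_def fls_X_inv_times_conv_shift(1))
qed

text \<open>Up to a nonzero factor the residue is that of the derivative of F^(i+1), and derivatives
  have residue 0.\<close>

lemma const_coeff_inv_F_power:
  assumes "lam \<noteq> 0"
  shows "const_coeff_inv_F lam (F_ser lam ^ (i + 1)) = 0"
proof -
  let ?F = "F_ser lam"
  have "fls_deriv (?F ^ (i + 1)) = fls_const (real (i + 1)) * (?F ^ i * fls_deriv ?F)"
    unfolding fls_deriv_power fls_of_nat by (simp add: mult_ac)
  then have "real (i + 1) * fls_residue (?F ^ i * fls_deriv ?F) = 0"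
    by (metis fls_residue_deriv fls_residue_fls_const_times(1))
  moreover have "?F ^ (i + 1) * (- fls_deriv ?F / ?F) = - (?F ^ i * fls_deriv ?F)"
    using F_ser_nz(1)[OF assms] by simp
  ultimately show ?thesis by (simp only: const_coeff_inv_F_def) simp
qed

text \<open>
  This is the coefficient of \<open>z ^ (i + 1)\<close> in \<open>1 + t = (1 + lam z) ^ (1 / lam)\<close>. Instead of expanding,
  one evaluates \<open>fls_residue ((1 + fls_X) * F' * F ^ i)\<close> both by parts and by the
  differential equation of \<open>F\<close>, which gives a recurrence in \<open>i\<close>.
\<close>

lemma const_coeff_inv_F_one_plus_X_power:
  assumes "lam \<noteq> 0"
  shows "const_coeff_inv_F lam ((1 + fls_X) * F_ser lam ^ (i + 1)) = gen_ffact 1 (i + 1) lam / fact (i + 1)"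
proof -
  let ?F = "F_ser lam"
  let ?r = "\<lambda>j. fls_residue (?F ^ (j + 1))"
  let ?L = "\<lambda>j. const_coeff_inv_F lam ((1 + fls_X) * ?F ^ (j + 1))"
  have L: "?L j = - fls_residue (?F ^ j * ((1 + fls_X) * fls_deriv ?F))" for j
  proof -
    have "(1 + fls_X) * ?F ^ (j + 1) * (- fls_deriv ?F / ?F) = - (?F ^ j * ((1 + fls_X) * fls_deriv ?F))"
      using F_ser_nz(1)[OF assms] by (simp add: mult_ac)
    then show ?thesis by (simp only: const_coeff_inv_F_def) simp
  qed
  have parts: "real (j + 1) * ?L j = ?r j" for j
  proof -
    have "fls_deriv ((1 + fls_X) * ?F ^ (j + 1)) =
        ?F ^ (j + 1) + fls_const (real (j + 1)) * (?F ^ j * ((1 + fls_X) * fls_deriv ?F))"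
      unfolding fls_deriv_mult fls_deriv_power fls_of_nat by (simp add: mult_ac)
    then have "?r j + real (j + 1) * fls_residue (?F ^ j * ((1 + fls_X) * fls_deriv ?F)) = 0"
      by (metis fls_residue_deriv fls_residue_add fls_residue_fls_const_times(1))
    then show ?thesis unfolding L by simp
  qed
  have ode: "?L j = lam * ?r j + ?r (Suc j)" for j
  proof -
    have "?F ^ j * ((1 + fls_X) * fls_deriv ?F) = - (fls_const lam * ?F ^ (j + 1) + ?F ^ (Suc j + 1))"
      unfolding one_plus_X_times_deriv_F_ser[OF assms] by (simp add: algebra_simps power2_eq_square)
    then show ?thesis unfolding L by simp
  qed
  show ?thesis
  proof (induction i)
    case 0
    have "?r 0 = 1"
    proof -
      have "fls_nth (fls_X * ?F) 0 = 1"
        using fls_X_times_F_ser[OF assms] by simp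
      then show ?thesis by (simp add: fls_X_times_conv_shift(1))
    qed
    then show ?case using parts[of 0] by (simp add: gen_ffact_def)
  next
    case (Suc i)
    \<comment> \<open>Eliminating \<open>?r\<close> between \<open>parts\<close> and
      \<open>ode\<close> leaves a two-term recurrence whose factor 1 - (i + 1) lam is the next
      factor of the generalized falling factorial.\<close>
    have "real (Suc i + 1) * ?L (Suc i) = ?L i - lam * ?r i"
      unfolding parts[of "Suc i"] using ode[of i] by simp
    also have "\<dots> = (1 - lam * real (i + 1)) * ?L i"
      unfolding parts[of i, symmetric] by (simp only: left_diff_distrib mult_1_left mult.assoc)
    finally have "?L (Suc i) = (1 - lam * real (i + 1)) * ?L i / real (Suc i + 1)"
      by (simp add: field_simps)
    also have "\<dots> = gen_ffact 1 (Suc i + 1) lam / fact (Suc i + 1)"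
      unfolding Suc.IH by (simp add: gen_ffact_Suc field_simps)
    finally show ?case .
  qed
qed

section \<open>Higher derivatives of t F and the first formula\<close>

lemma funpow_fls_deriv_X_times:
  "(fls_deriv ^^ n) (fls_X * f) =
    fls_X * (fls_deriv ^^ n) f + of_nat n * (fls_deriv ^^ (n - 1)) (f :: real fls)"
proof (induction n)
  case (Suc n)
  then show ?case by (cases n) (simp_all add: fls_deriv_add algebra_simps)
qed simp

lemma funpow_fls_deriv_fps_to_fls:
  "(fls_deriv ^^ n) (fps_to_fls g) = fps_to_fls ((fps_deriv ^^ n) g)"
  by (induction n) (simp_all add: fls_deriv_fps_to_fls)

lemma deg_bernoulli2_deriv_coeff:
  assumes "lam \<noteq> 0"
  shows "deg_bernoulli2 lam n = (-1) ^ n * (\<Sum>i\<le>n. gen_ffact 1 (i + 1) lam / fact (i + 1) *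
    (deriv_coeff lam i n - real n * deriv_coeff lam i (n - 1)))"
proof -
  let ?F = "F_ser lam"
  let ?T = "- (1 + fls_X) :: real fls"
  let ?a = "deriv_coeff lam"
  define G where "G = Abs_fps (\<lambda>n. deg_bernoulli2 lam n / fact n)"
  have XF: "fls_X * ?F = fps_to_fls G"
    using fls_X_times_F_ser[OF assms] by (simp add: G_def)
  define P where "P N = (\<Sum>i\<le>N. fls_const (?a i N) * ?F ^ (i + 1))" for N
  have P: "?T ^ N * (fls_deriv ^^ N) ?F = P N" for N
    using is_deriv_coeffs_deriv_coeff[OF assms, of N] by (simp only: is_deriv_coeffs_alt P_def)
  \<comment> \<open>For n = 0 the truncated exponent n - 1 is harmless, because both sides are
    0.\<close>
  have Tn: "of_nat n * ?T ^ n = of_nat n * ?T * ?T ^ (n - 1)"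
    by (cases n) simp_all
  have "?T ^ n * fps_to_fls ((fps_deriv ^^ n) G) = ?T ^ n * (fls_deriv ^^ n) (fls_X * ?F)"
    by (simp only: XF funpow_fls_deriv_fps_to_fls)
  also have "\<dots> = fls_X * (?T ^ n * (fls_deriv ^^ n) ?F) +
      of_nat n * ?T ^ n * (fls_deriv ^^ (n - 1)) ?F"
    unfolding funpow_fls_deriv_X_times by (simp only: algebra_simps)
  also have "\<dots> = fls_X * P n + of_nat n * ?T * P (n - 1)"
    unfolding Tn P[symmetric] by (simp only: mult.assoc)
  also have "\<dots> = (1 + fls_X) * (P n - of_nat n * P (n - 1)) - P n"
    by (simp add: algebra_simps)
  also have "P n - of_nat n * P (n - 1) =
      (\<Sum>i\<le>n. fls_const (?a i n - real n * ?a i (n - 1)) * ?F ^ (i + 1))"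
  proof -
    have "P (n - 1) = (\<Sum>i\<le>n. fls_const (?a i (n - 1)) * ?F ^ (i + 1))"
      unfolding P_def by (rule sum.mono_neutral_left) (auto simp: deriv_coeff_eq_0 assms)
    then show ?thesis
      unfolding P_def[of n] by (simp only: fls_of_nat sum_distrib_left sum_subtractf[symmetric]
        fls_minus_const[symmetric] fls_const_mult_const[symmetric] left_diff_distrib mult.assoc)
  qed
  finally have key: "?T ^ n * fps_to_fls ((fps_deriv ^^ n) G) =
      (\<Sum>i\<le>n. fls_const (?a i n - real n * ?a i (n - 1)) * ((1 + fls_X) * ?F ^ (i + 1))) - P n"
    by (simp only: sum_distrib_left mult.left_commute)
  have "?T ^ n * fps_to_fls ((fps_deriv ^^ n) G) =
      fps_to_fls ((- (1 + fps_X)) ^ n * (fps_deriv ^^ n) G)"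
    by (simp add: fls_times_fps_to_fls fps_to_fls_power)
  \<comment> \<open>The argument is a power series in t, so its value at t = 0 is taken: (-1)^n
    times the n-th derivative of \<open>G\<close> at 0.\<close>
  then have "const_coeff_inv_F lam (?T ^ n * fps_to_fls ((fps_deriv ^^ n) G)) =
      (-1) ^ n * deg_bernoulli2 lam n"
    by (simp add: const_coeff_inv_F_fps assms fps_0th_higher_deriv G_def fps_power_zeroth)
  also have "const_coeff_inv_F lam (?T ^ n * fps_to_fls ((fps_deriv ^^ n) G)) =
      (\<Sum>i\<le>n. (?a i n - real n * ?a i (n - 1)) * (gen_ffact 1 (i + 1) lam / fact (i + 1)))"
    unfolding key P_def
    by (simp only: const_coeff_inv_F_diff const_coeff_inv_F_sum const_coeff_inv_F_const_times
      const_coeff_inv_F_power[OF assms] const_coeff_inv_F_one_plus_X_power[OF assms]) simp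
  finally have "(-1) ^ n * ((-1) ^ n * deg_bernoulli2 lam n) =
      (-1) ^ n * (\<Sum>i\<le>n. (gen_ffact 1 (i + 1) lam / fact (i + 1)) * (?a i n - real n * ?a i (n - 1)))"
    by (simp only: mult.commute[of "gen_ffact _ _ _ / _"])
  then show ?thesis by (simp add: power_mult_distrib[symmetric] flip: mult.assoc)
qed

section \<open>Passage to finite differences and the three formulas\<close>

lemma deriv_coeff_diff_eq_sum:
  assumes "lam \<noteq> 0"
  shows "(-1) ^ n * (deriv_coeff lam i n - real n * deriv_coeff lam i (n - 1)) =
    1 / lam ^ i * (\<Sum>k=i..n. real (k choose i) * (ffact_diff lam n k + real n * ffact_diff lam (n - 1) k))"
proof -
  \<comment> \<open>Gives the sums for m = n and m = n - 1 one common range: differences vanish for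
    k > m, binomials for k < i.\<close>
  have ext: "(\<Sum>k\<le>m. real (k choose i) * ffact_diff lam m k) =
      (\<Sum>k=i..n. real (k choose i) * ffact_diff lam m k)" if "m \<le> n" for m
  proof -
    have "(\<Sum>k\<le>m. real (k choose i) * ffact_diff lam m k) =
        (\<Sum>k\<le>n. real (k choose i) * ffact_diff lam m k)"
      using that assms by (intro sum.mono_neutral_left) (auto simp: ffact_diff_eq_0)
    also have "\<dots> = (\<Sum>k=i..n. real (k choose i) * ffact_diff lam m k)"
      by (intro sum.mono_neutral_right) auto
    finally show ?thesis .
  qed
  \<comment> \<open>The opposite signs of levels n and n - 1 turn the difference of coefficients
    into a sum.\<close>
  have sgn: "real n * ((-1) ^ n * (-1) ^ (n - 1)) = - real n"
    by (cases n) simp_all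
  have "(-1) ^ n * ((-1) ^ n / lam ^ i * u - real n * ((-1) ^ (n - 1) / lam ^ i * v)) =
      1 / lam ^ i * ((-1) ^ n * (-1) ^ n * u - real n * ((-1) ^ n * (-1) ^ (n - 1)) * v)" for u v
    by (simp only: right_diff_distrib divide_inverse mult_ac mult_1_left)
  then have combine: "(-1) ^ n * ((-1) ^ n / lam ^ i * u - real n * ((-1) ^ (n - 1) / lam ^ i * v)) =
      1 / lam ^ i * (u + real n * v)" for u v
    unfolding sgn by simp
  show ?thesis
    unfolding deriv_coeff_eq_sum[OF assms] ext[OF order.refl] ext[OF diff_le_self] combine
    by (simp add: sum_distrib_left sum.distrib algebra_simps)
qed

lemma ffact_diff_plus:
  "ffact_diff lam n k + real n * ffact_diff lam (n - 1) k =
    (\<Sum>l=0..k. (-1) ^ l * real (k choose l) * gen_ffact (lam * real l + 1) n 1)"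
  unfolding ffact_diff_def gen_ffact_plus_1 sum_distrib_left sum.distrib[symmetric] atLeast0AtMost
  by (intro sum.cong refl) (simp add: algebra_simps)

theorem theorem3p3:
  fixes lam :: real and n :: nat
  assumes "lam \<noteq> 0"
  shows
    "deg_bernoulli2 lam n =
       (-1) ^ n * (gen_ffact 1 (n + 1) lam / (real n + 1) +
         (\<Sum>i<n. gen_ffact 1 (i + 1) lam / fact (i + 1) *
            (deriv_coeff lam i n - real n * deriv_coeff lam i (n - 1)))) \<and>
     deg_bernoulli2 lam n =
       (-1) ^ n * gen_ffact 1 (n + 1) lam / (real n + 1) +
         (\<Sum>i<n. \<Sum>k=i..n. gen_ffact 1 (i + 1) lam / fact (i + 1) *
            (-1) ^ k * fact k * real (k choose i) * lam ^ (n - i - 1) *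
            (lam * deg_stirling2 (1 / lam) n k + real n * deg_stirling2 (1 / lam) (n - 1) k)) \<and>
     deg_bernoulli2 lam n =
       (-1) ^ n * gen_ffact 1 (n + 1) lam / (real n + 1) +
         (\<Sum>i<n. gen_ffact 1 (i + 1) lam / fact (i + 1) * (1 / lam ^ i) *
            ((\<Sum>l=0..n. (-1) ^ l * real (n choose i) * real (n choose l) *
                 gen_ffact (lam * real l) n 1) +
             (\<Sum>k=i..<n. \<Sum>l=0..k. (-1) ^ l * real (k choose i) * real (k choose l) *
                 gen_ffact (lam * real l + 1) n 1)))"
proof -
  let ?c = "\<lambda>i. gen_ffact 1 (i + 1) lam / fact (i + 1)"
  let ?d = "\<lambda>i. deriv_coeff lam i n - real n * deriv_coeff lam i (n - 1)"
  let ?b = "(-1) ^ n * gen_ffact 1 (n + 1) lam / (real n + 1)"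
  have "real n * deriv_coeff lam n (n - 1) = 0"
    by (cases n) (simp_all add: deriv_coeff_eq_0 assms)
  then have "?d n = fact n"
    by (simp only: deriv_coeff_diag[OF assms] diff_zero)
  \<comment> \<open>The isolated leading term is the summand i = n, as n! / (n + 1)! = 1 / (n +
    1).\<close>
  then have top: "?c n * ?d n = gen_ffact 1 (n + 1) lam / (real n + 1)"
    by (simp only:) simp
  have 1: "deg_bernoulli2 lam n =
      (-1) ^ n * (gen_ffact 1 (n + 1) lam / (real n + 1) + (\<Sum>i<n. ?c i * ?d i))"
    unfolding deg_bernoulli2_deriv_coeff[OF assms] lessThan_Suc_atMost[symmetric] sum.lessThan_Suc top
    by (simp only: add.commute)
  have split: "deg_bernoulli2 lam n = ?b + (\<Sum>i<n. ?c i * ((-1) ^ n * ?d i))"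
    unfolding 1 by (simp add: distrib_left sum_distrib_left mult_ac)
  have 2: "?c i * ((-1) ^ n * ?d i) = (\<Sum>k=i..n. ?c i * (-1) ^ k * fact k * real (k choose i) *
      lam ^ (n - i - 1) * (lam * deg_stirling2 (1 / lam) n k + real n * deg_stirling2 (1 / lam) (n - 1) k))"
    if "i < n" for i
  proof -
    \<comment> \<open>The two differences carry lam^n and lam^(n-1); after division by lam^i the
      common factor is lam^(n-i-1), and i < n prevents truncation.\<close>
    have p: "lam ^ n = lam ^ i * lam ^ (n - i - 1) * lam" "lam ^ (n - 1) = lam ^ i * lam ^ (n - i - 1)"
      using that by (simp_all flip: power_add power_Suc2)
    show ?thesis
      unfolding deriv_coeff_diff_eq_sum[OF assms] sum_distrib_left
      using assms by (intro sum.cong refl)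
        (simp add: ffact_diff_eq_deg_stirling2 p[unfolded One_nat_def] field_simps del: fact_Suc)
  qed
  have 3: "?c i * ((-1) ^ n * ?d i) = ?c i * (1 / lam ^ i) *
      ((\<Sum>l=0..n. (-1) ^ l * real (n choose i) * real (n choose l) * gen_ffact (lam * real l) n 1) +
       (\<Sum>k=i..<n. \<Sum>l=0..k. (-1) ^ l * real (k choose i) * real (k choose l) *
         gen_ffact (lam * real l + 1) n 1))"
    if "i < n" for i
  proof -
    \<comment> \<open>Hence the summand k = n keeps the unshifted (lam l)_n, while those with k < n
      merge into (lam l + 1)_n.\<close>
    have "real n * ffact_diff lam (n - 1) n = 0"
      using that assms by (simp add: ffact_diff_eq_0)
    then have n: "real (n choose i) * (ffact_diff lam n n + real n * ffact_diff lam (n - 1) n) =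
        (\<Sum>l=0..n. (-1) ^ l * real (n choose i) * real (n choose l) * gen_ffact (lam * real l) n 1)"
      by (simp add: ffact_diff_def sum_distrib_left atLeast0AtMost mult_ac)
    have "{i..n} = insert n {i..<n}" using that by auto
    then have "(\<Sum>k=i..n. real (k choose i) * (ffact_diff lam n k + real n * ffact_diff lam (n - 1) k)) =
        real (n choose i) * (ffact_diff lam n n + real n * ffact_diff lam (n - 1) n) +
        (\<Sum>k=i..<n. real (k choose i) * (ffact_diff lam n k + real n * ffact_diff lam (n - 1) k))"
      by simp
    then show ?thesis
      unfolding deriv_coeff_diff_eq_sum[OF assms] n
      by (simp only: ffact_diff_plus sum_distrib_left mult_ac)
  qed
  show ?thesis
    by (intro conjI 1 trans[OF split] arg_cong2[where f = "(+)"] refl sum.cong 2 3) simp_all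
qed

end
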